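(* The quantity $\mathcal{M}$ is asymptotically continuous in the following sense: there exist constants $K$ and $C$, independent of the dimension $d$ and of the states, such that for every $d$ and all states $\varrho_1,\varrho_2$ on $\mathbb{C}^d\otimes\mathbb{C}^d$, $$|\mathcal{M}(\varrho_1)-\mathcal{M}(\varrho_2)|\leq K\,\varepsilon\,\log_2 d + C,$$ where $\varepsilon=\|\varrho_1-\varrho_2\|$ (trace norm).
   Context: A state on $\mathbb{C}^d\otimes\mathbb{C}^d$ is a density matrix (positive semidefinite, trace one). $\mathcal{PS}$ denotes the set of product states $\varrho_A\otimes\varrho_B$. A von Neumann measurement $\mathcal{P}=\{P_i\}$ is a complete family of mutually orthogonal rank-one projectors on $\mathbb{C}^d\otimes\mathbb{C}^d$ (not necessarily of product form) summing to the identity. The Klein entropy is $H(\varrho,\mathcal{P})=-\sum_i p_i\log_2 p_i$ with $p_i=\mathrm{Tr}(\varrho P_i)$ and $0\log_2 0=0$. The entropic entanglement parameter is $$\mathcal{M}(\varrho)=\sup_{\mathcal{P}}\Big(\inf_{\delta\in\mathcal{PS}}H(\delta,\mathcal{P})-H(\varrho,\mathcal{P})\Big),$$ the supremum being over all von Neumann measurements. *)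

theory Defs
  imports
    "Jordan_Normal_Form.Schur_Decomposition"
    "Jordan_Normal_Form.DL_Rank"
begin

definition mat_trace :: "complex mat \<Rightarrow> complex" where
  "mat_trace A = (\<Sum>i<dim_row A. A $$ (i, i))"

(* The order on complex is that of Complex_Order: 0 \<le> z means that z is real and
   nonnegative.  Hence every positive semidefinite matrix is Hermitian. *)
definition pos_semidef :: "nat \<Rightarrow> complex mat \<Rightarrow> bool" where
  "pos_semidef n A \<longleftrightarrow>
     A \<in> carrier_mat n n \<and> (\<forall>v \<in> carrier_vec n. 0 \<le> (A *\<^sub>v v) \<bullet>c v)"

definition density_matrices :: "nat \<Rightarrow> complex mat set" where
  "density_matrices n = {\<rho>. pos_semidef n \<rho> \<and> mat_trace \<rho> = 1}"

(* Sum of the singular values of A, that is, of the square roots of the eigenvalues of A\<^sup>\<dagger>A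
   counted with multiplicity; these eigenvalues are real and nonnegative. *)
definition trace_norm :: "complex mat \<Rightarrow> real" where
  "trace_norm A =
     (\<Sum>x\<in>#proots (char_poly (mat_adjoint A * A)). sqrt (Re x))"

(* Kronecker product.  The basis vector e_i \<otimes> e_j of C^m \<otimes> C^n is identified with the basis
   vector of index i * n + j of C^(m * n). *)
definition mat_tensor :: "complex mat \<Rightarrow> complex mat \<Rightarrow> complex mat" where
  "mat_tensor A B =
     mat (dim_row A * dim_row B) (dim_col A * dim_col B)
       (\<lambda>(i, j). A $$ (i div dim_row B, j div dim_col B) * B $$ (i mod dim_row B, j mod dim_col B))"

definition product_states :: "nat \<Rightarrow> complex mat set" where
  "product_states d =
     {mat_tensor \<rho>A \<rho>B | \<rho>A \<rho>B. \<rho>A \<in> density_matrices d \<and> \<rho>B \<in> density_matrices d}"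

definition rank_one_projector :: "nat \<Rightarrow> complex mat \<Rightarrow> bool" where
  "rank_one_projector n P \<longleftrightarrow>
     P \<in> carrier_mat n n \<and> mat_adjoint P = P \<and> P * P = P \<and> vec_space.rank n P = 1"

(* The family {P_i} is modelled as a set: orthogonality makes its members pairwise distinct. *)
definition von_neumann_measurement :: "nat \<Rightarrow> complex mat set \<Rightarrow> bool" where
  "von_neumann_measurement n \<P> \<longleftrightarrow>
     finite \<P> \<and>
     (\<forall>P\<in>\<P>. rank_one_projector n P) \<and>
     (\<forall>P\<in>\<P>. \<forall>Q\<in>\<P>. P \<noteq> Q \<longrightarrow> P * Q = 0\<^sub>m n n) \<and>
     mat n n (\<lambda>(i, j). \<Sum>P\<in>\<P>. P $$ (i, j)) = 1\<^sub>m n"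

definition outcome_prob :: "complex mat \<Rightarrow> complex mat \<Rightarrow> real" where
  "outcome_prob \<rho> P = Re (mat_trace (\<rho> * P))"

(* Since log 2 0 is a real number, the summand is 0 when the probability is 0. *)
definition klein_entropy :: "complex mat \<Rightarrow> complex mat set \<Rightarrow> real" where
  "klein_entropy \<rho> \<P> = - (\<Sum>P\<in>\<P>. outcome_prob \<rho> P * log 2 (outcome_prob \<rho> P))"

(* For d > 0 the real SUP and INF are taken over nonempty sets, and every Klein entropy of a
   density matrix lies between 0 and log 2 (d * d). *)
definition entropic_entanglement :: "nat \<Rightarrow> complex mat \<Rightarrow> real" where
  "entropic_entanglement d \<rho> =
     (SUP \<P> \<in> {\<P>. von_neumann_measurement (d * d) \<P>}.
        (INF \<delta> \<in> product_states d. klein_entropy \<delta> \<P>) - klein_entropy \<rho> \<P>)"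

end

theory Submission
  imports Defs
begin

text \<open>Both suprema run over the same measurements and the infimum over product states cancels,
  so \<open>\<M>\<close> varies by at most the largest variation of the Klein entropy. For a fixed measurement
  the \<open>\<ell>\<^sub>1\<close> distance of the two outcome distributions is at most the trace norm of
  \<open>\<rho>\<^sub>1 - \<rho>\<^sub>2\<close>: diagonalise the Hermitian difference and replace its eigenvalues by their absolute
  values. There are at most \<open>d\<^sup>2\<close> outcomes, each projector having trace at least one, and a
  pointwise Fannes-type estimate for \<open>x ln x\<close> gives the claim with \<open>K = 2\<close> and \<open>C = 3 / ln 2\<close>.\<close>

section \<open>Unitary diagonalisation of Hermitian matrices\<close>

lemma square_mult_carrier [simp]:
  "A \<in> carrier_mat n n \<Longrightarrow> B \<in> carrier_mat n n \<Longrightarrow> A * B \<in> carrier_mat n n"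
  by (rule mult_carrier_mat)

lemma square_mult_assoc:
  fixes A B C :: "'a :: semiring_0 mat"
  shows "A \<in> carrier_mat n n \<Longrightarrow> B \<in> carrier_mat n n \<Longrightarrow> C \<in> carrier_mat n n \<Longrightarrow> A * B * C = A * (B * C)"
  by (rule assoc_mult_mat)

lemma adjoint_carrier [simp]: "A \<in> carrier_mat m n \<Longrightarrow> mat_adjoint A \<in> carrier_mat n m"
  unfolding mat_adjoint_def by (auto simp: mat_of_rows_def)

lemma adjoint_dim [simp]: "dim_row (mat_adjoint A) = dim_col A" "dim_col (mat_adjoint A) = dim_row A"
  unfolding mat_adjoint_def by (auto simp: mat_of_rows_def)

lemma adjoint_index [simp]:
  "i < dim_col A \<Longrightarrow> j < dim_row A \<Longrightarrow> mat_adjoint A $$ (i, j) = conjugate (A $$ (j, i))"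
  unfolding mat_adjoint_def by (simp add: mat_of_rows_def)

lemma adjoint_mult:
  fixes A :: "'a :: conjugatable_field mat"
  assumes "A \<in> carrier_mat l m" "B \<in> carrier_mat m n"
  shows "mat_adjoint (A * B) = mat_adjoint B * mat_adjoint A"
  using assms
  by (intro eq_matI) (auto simp: scalar_prod_def sum_conjugate conjugate_dist_mul mult.commute intro!: sum.cong)

lemma adjoint_adjoint [simp]: "mat_adjoint (mat_adjoint A) = A"
  by (intro eq_matI) auto

lemma adjoint_minus:
  fixes A :: "complex mat"
  assumes "A \<in> carrier_mat m n" "B \<in> carrier_mat m n"
  shows "mat_adjoint (A - B) = mat_adjoint A - mat_adjoint B"
  using assms by (intro eq_matI) auto

text \<open>\<open>corthogonal\<close> makes distinct vectors orthogonal and every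
  \<open>ws ! i\<close> non-isotropic, so no norm vanishes and dividing by the norms gives
  orthonormal columns.\<close>

lemma corthogonal_unitary:
  fixes ws :: "complex vec list"
  assumes ws: "set ws \<subseteq> carrier_vec n" "corthogonal ws" "length ws = n"
  defines "W \<equiv> mat n n (\<lambda>(i, j). ws ! j $ i / complex_of_real (sqrt (Re (ws ! j \<bullet>c ws ! j))))"
  shows "mat_adjoint W * W = 1\<^sub>m n"
proof (intro eq_matI)
  fix i j assume "i < dim_row (1\<^sub>m n :: complex mat)" "j < dim_col (1\<^sub>m n :: complex mat)"
  hence i: "i < n" and j: "j < n" by auto
  define s where "s k = complex_of_real (sqrt (Re (ws ! k \<bullet>c ws ! k)))" for k
  have carr: "ws ! k \<in> carrier_vec n" if "k < n" for k
    using ws that by auto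
  have "(mat_adjoint W * W) $$ (i, j) = (\<Sum>k<n. conjugate (ws ! i $ k / s i) * (ws ! j $ k / s j))"
    using i j by (simp add: W_def s_def scalar_prod_def lessThan_atLeast0)
  also have "\<dots> = (ws ! j \<bullet>c ws ! i) / (s i * s j)"
    using carr[OF i] carr[OF j]
    by (simp add: scalar_prod_def lessThan_atLeast0 sum_divide_distrib s_def mult.commute)
  also have "\<dots> = 1\<^sub>m n $$ (i, j)"
  proof (cases "i = j")
    case True
    have "ws ! i \<bullet>c ws ! i \<ge> 0" by (rule conjugate_square_ge_0_vec)
    moreover have "ws ! i \<bullet>c ws ! i \<noteq> 0"
      using corthogonalD[OF ws(2), of i i] i ws(3) by simp
    ultimately have "Re (ws ! i \<bullet>c ws ! i) > 0" "Im (ws ! i \<bullet>c ws ! i) = 0"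
      by (auto simp: less_eq_complex_def complex_eq_iff)
    hence "s i * s i = ws ! i \<bullet>c ws ! i"
      by (simp add: s_def complex_eq_iff)
    thus ?thesis using True i \<open>ws ! i \<bullet>c ws ! i \<noteq> 0\<close> by simp
  next
    case False
    thus ?thesis using corthogonalD[OF ws(2), of j i] i j ws(3) by simp
  qed
  finally show "(mat_adjoint W * W) $$ (i, j) = 1\<^sub>m n $$ (i, j)" .
qed (auto simp: W_def)

text \<open>Over the complex numbers the characteristic polynomial splits, so an eigenvector exists
  as soon as the dimension is nonzero. Completing it to a basis, orthogonalising and normalising
  makes it the first column of a unitary.\<close>

lemma unitary_with_eigenvector:
  fixes A :: "complex mat"
  assumes A: "A \<in> carrier_mat n n" and n: "n \<noteq> 0"
  obtains W e where "W \<in> carrier_mat n n" "mat_adjoint W * W = 1\<^sub>m n"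
    "A *\<^sub>v col W 0 = e \<cdot>\<^sub>v col W 0"
proof -
  from char_poly_factorized[OF A] obtain as where
    as: "char_poly A = (\<Prod>a\<leftarrow>as. [:- a, 1:])" "length as = n" by auto
  with n obtain e es where "as = e # es" by (cases as) auto
  with as have "poly (char_poly A) e = 0" by simp
  hence "eigenvalue A e" using eigenvalue_root_char_poly[OF A] by simp
  then obtain v where "eigenvector A v e" unfolding eigenvalue_def by blast
  hence v: "v \<in> carrier_vec n" "v \<noteq> 0\<^sub>v n" "A *\<^sub>v v = e \<cdot>\<^sub>v v"
    using A unfolding eigenvector_def by auto
  interpret cof_vec_space n "TYPE(complex)" .
  define b where "b = basis_completion v"
  define ws where "ws = gram_schmidt n b"
  note bc = basis_completion[OF v(1,2), folded b_def]
  from gram_schmidt_result[OF bc(2,4,5) refl, folded ws_def]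
  have ws: "set ws \<subseteq> carrier_vec n" "corthogonal ws" "length ws = n" using bc by auto
  \<comment> \<open>Gram-Schmidt leaves the first vector unchanged, so the eigenvector survives at
    index 0.\<close>
  obtain vs where "b = v # vs" using bc n by (cases b) auto
  hence "hd ws = v" using gram_schmidt_hd[OF v(1), of vs] unfolding ws_def by simp
  hence ws0: "ws ! 0 = v" using n ws(3) by (metis hd_conv_nth list.size(3))
  define s where "s = complex_of_real (sqrt (Re (v \<bullet>c v)))"
  define W where "W = mat n n (\<lambda>(i, j). ws ! j $ i / complex_of_real (sqrt (Re (ws ! j \<bullet>c ws ! j))))"
  have "col W 0 = (1 / s) \<cdot>\<^sub>v v"
    using n v(1) by (intro eq_vecI) (auto simp: W_def s_def ws0)
  moreover have "A *\<^sub>v ((1 / s) \<cdot>\<^sub>v v) = e \<cdot>\<^sub>v ((1 / s) \<cdot>\<^sub>v v)"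
    using A v by (simp add: mult_mat_vec smult_smult_assoc mult.commute)
  ultimately have "A *\<^sub>v col W 0 = e \<cdot>\<^sub>v col W 0" by simp
  moreover have "mat_adjoint W * W = 1\<^sub>m n"
    unfolding W_def by (rule corthogonal_unitary[OF ws])
  ultimately show ?thesis using that[of W e] by (simp add: W_def)
qed

text \<open>Spectral theorem by deflation: a unitary with an eigenvector in column 0 splits off a
  1x1 block, and hermiticity passes to the remaining block, to which the induction hypothesis
  applies.\<close>

lemma hermitian_diagonalisation:
  fixes A :: "complex mat"
  assumes "A \<in> carrier_mat n n" "mat_adjoint A = A"
  shows "\<exists>U (d :: nat \<Rightarrow> real). U \<in> carrier_mat n n \<and> mat_adjoint U * U = 1\<^sub>m n \<and>
           mat_adjoint U * A * U = mat_diag n (\<lambda>k. complex_of_real (d k))"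
  using assms
proof (induction n arbitrary: A)
  case 0
  thus ?case by (intro exI[of _ "1\<^sub>m 0"] exI[of _ "\<lambda>_. 0"]) (auto intro!: eq_matI simp: mat_diag_def)
next
  case (Suc n)
  note A = Suc.prems(1)
  obtain W e where W: "W \<in> carrier_mat (Suc n) (Suc n)" "mat_adjoint W * W = 1\<^sub>m (Suc n)"
    and ev: "A *\<^sub>v col W 0 = e \<cdot>\<^sub>v col W 0"
    using unitary_with_eigenvector[OF A] by blast
  define B where "B = mat_adjoint W * A * W"
  have B: "B \<in> carrier_mat (Suc n) (Suc n)" using A W(1) by (simp add: B_def)
  have adjB: "mat_adjoint B = B"
    using A W(1) Suc.prems(2)
    by (simp add: B_def adjoint_mult[of _ "Suc n" "Suc n" _ "Suc n"] square_mult_assoc[of _ "Suc n"])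
  have herm: "B $$ (i, j) = conjugate (B $$ (j, i))" if "i < Suc n" "j < Suc n" for i j
    using arg_cong[OF adjB, of "\<lambda>M. M $$ (i, j)"] that B by simp
  \<comment> \<open>Column 0 of \<open>W\<close> is an eigenvector and is orthonormal to the other
    columns, so the first column of \<open>B\<close> is a multiple of that of
    \<open>W\<^sup>\<dagger>W = 1\<close>.\<close>
  have col0: "B $$ (i, 0) = (if i = 0 then e else 0)" if "i < Suc n" for i
  proof -
    have "B $$ (i, 0) = (mat_adjoint W * (A * W)) $$ (i, 0)"
      using A W(1) by (simp add: B_def square_mult_assoc[of _ "Suc n"])
    also have "\<dots> = row (mat_adjoint W) i \<bullet> (A *\<^sub>v col W 0)"
      using A W(1) that by (subst index_mult_mat) (auto simp: mult_mat_vec_def)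
    also have "\<dots> = e * (mat_adjoint W * W) $$ (i, 0)"
      using W(1) that unfolding ev by (simp)
    finally show ?thesis using that unfolding W(2) by simp
  qed
  \<comment> \<open>A diagonal entry of a Hermitian matrix is its own conjugate; with
    \<open>e\<close> real, conjugating the first column also clears the first row.\<close>
  have e: "Im e = 0"
    using herm[of 0 0] col0[of 0] by (simp add: complex_eq_iff)
  have row0: "B $$ (0, i) = (if i = 0 then e else 0)" if "i < Suc n" for i
    using herm[of 0 i] col0[of i] that e by (auto simp: complex_eq_iff)
  define C where "C = mat n n (\<lambda>(i, j). B $$ (Suc i, Suc j))"
  have C: "C \<in> carrier_mat n n" by (simp add: C_def)
  have "mat_adjoint C $$ (i, j) = C $$ (i, j)" if "i < n" "j < n" for i j
    using herm[of "Suc i" "Suc j"] that by (simp add: C_def)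
  hence "mat_adjoint C = C" by (intro eq_matI) (auto simp: C_def)
  from Suc.IH[OF C this] obtain V d where V: "V \<in> carrier_mat n n" "mat_adjoint V * V = 1\<^sub>m n"
    and D: "mat_adjoint V * C * V = mat_diag n (\<lambda>k. complex_of_real (d k))" by blast
  let ?blk = "\<lambda>a M. four_block_mat (mat 1 1 (\<lambda>_. a)) (0\<^sub>m 1 n) (0\<^sub>m n 1) M"
  \<comment> \<open>The diagonalising unitary of the smaller block is extended by 1, so it leaves
    the split-off eigenvalue untouched.\<close>
  define V' where "V' = ?blk 1 V"
  have Bblk: "B = ?blk e C"
    using B row0 col0 by (intro eq_matI) (auto simp: C_def)
  have V': "V' \<in> carrier_mat (Suc n) (Suc n)" using V(1) by (auto simp: V'_def)
  have adjV': "mat_adjoint V' = ?blk 1 (mat_adjoint V)"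
    using V(1) by (intro eq_matI) (auto simp: V'_def)
  have blk_mult: "?blk a M * ?blk b N = ?blk (a * b) (M * N)"
    if "M \<in> carrier_mat n n" "N \<in> carrier_mat n n" for a b :: complex and M N
    using that
    by (subst mult_four_block_mat[of _ 1 1 _ n _ n _ _ 1 _ n])
       (auto intro!: cong_four_block_mat eq_matI simp: scalar_prod_def)
  let ?U = "W * V'"
  have "mat_adjoint ?U * ?U = mat_adjoint V' * (mat_adjoint W * W) * V'"
    using W(1) V' by (simp add: adjoint_mult[of _ "Suc n" "Suc n" _ "Suc n"] square_mult_assoc[of _ "Suc n"])
  also have "\<dots> = mat_adjoint V' * V'" using W(2) V' by simp
  also have "\<dots> = ?blk 1 (1\<^sub>m n)"
    unfolding adjV' unfolding V'_def using V by (subst blk_mult) auto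
  also have "\<dots> = 1\<^sub>m (Suc n)" by (intro eq_matI) auto
  finally have unit: "mat_adjoint ?U * ?U = 1\<^sub>m (Suc n)" .
  have "mat_adjoint ?U * A * ?U = mat_adjoint V' * B * V'"
    using W(1) V' A by (simp add: B_def adjoint_mult[of _ "Suc n" "Suc n" _ "Suc n"] square_mult_assoc[of _ "Suc n"])
  also have "\<dots> = ?blk e (mat_adjoint V * C * V)"
    unfolding adjV' Bblk unfolding V'_def using V C by (subst blk_mult, simp, simp, subst blk_mult, auto)
  also have "\<dots> = mat_diag (Suc n) (\<lambda>k. complex_of_real (case k of 0 \<Rightarrow> Re e | Suc k \<Rightarrow> d k))"
    unfolding D using e by (intro eq_matI) (auto simp: mat_diag_def complex_eq_iff split: nat.split)
  finally show ?case using unit W(1) V'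
    by (intro exI[of _ ?U] exI[of _ "\<lambda>k. case k of 0 \<Rightarrow> Re e | Suc k \<Rightarrow> d k"]) auto
qed

section \<open>A Fannes-type inequality\<close>

text \<open>This is ln t \<le> t - 1 at t = 1/(rn), multiplied by \<open>r\<close>, with a term -r
  dropped. The parameter \<open>n\<close> will be a bound on the number of outcomes, so that the
  errors 1/n add up to at most 1.\<close>

lemma neg_x_ln_le:
  fixes r n :: real
  assumes "0 \<le> r" "0 < n"
  shows "- (r * ln r) \<le> r * ln n + 1 / n"
proof (cases "r = 0")
  case False
  with assms have r: "r > 0" by simp
  have "ln (1 / (r * n)) \<le> 1 / (r * n) - 1"
    using r assms by (intro ln_le_minus_one) simp
  hence "r * ln (1 / (r * n)) \<le> r * (1 / (r * n) - 1)"
    using r by (intro mult_left_mono) auto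
  moreover have "ln (1 / (r * n)) = - ln r - ln n"
    using r assms by (simp add: ln_div ln_mult)
  moreover have "r * (1 / (r * n) - 1) = 1 / n - r"
    using r assms by (simp add: field_simps)
  moreover have "r * (- ln r - ln n) = - (r * ln r) - r * ln n" by (simp add: algebra_simps)
  ultimately show ?thesis using r by simp
qed (use assms in simp)

text \<open>The increase of x ln x from \<open>p\<close> to \<open>q\<close> is at most q - p
  because ln t \<le> t - 1 and ln q \<le> 0. The decrease is controlled by superadditivity of x ln
  x, which reduces it to \<open>neg_x_ln_le\<close> at r = q - p.\<close>

lemma x_ln_diff_le:
  fixes p q n :: real
  assumes "0 \<le> p" "p \<le> q" "q \<le> 1" "1 \<le> n"
  shows "\<bar>p * ln p - q * ln q\<bar> \<le> (q - p) * ln n + (q - p) + 1 / n"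
proof (cases "p = 0")
  case True
  have "q * ln q \<le> 0" using assms by (intro mult_nonneg_nonpos) (auto simp: ln_le_zero_iff le_less)
  thus ?thesis using neg_x_ln_le[of q n] assms True by simp
next
  case False
  with assms have p: "p > 0" "q > 0" by auto
  have "p * ln (q / p) \<le> p * (q / p - 1)"
    using p by (intro mult_left_mono ln_le_minus_one) auto
  hence "p * (ln q - ln p) \<le> q - p"
    using p by (simp add: ln_div right_diff_distrib)
  moreover have "(q - p) * ln q \<le> 0"
    using assms p by (intro mult_nonneg_nonpos) (auto)
  ultimately have up: "q * ln q - p * ln p \<le> q - p"
    by (simp add: algebra_simps)
  \<comment> \<open>Superadditivity: both ln p and ln (q - p) are at most ln q, and the weights
    \<open>p\<close> and \<open>q - p\<close> add up to \<open>q\<close>. If q = p, the factor q - p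
    vanishes.\<close>
  have "p * ln p \<le> p * ln q" using p assms by simp
  moreover have "(q - p) * ln (q - p) \<le> (q - p) * ln q"
    using p assms by (cases "q = p") auto
  ultimately have "p * ln p + (q - p) * ln (q - p) \<le> q * ln q"
    by (simp add: algebra_simps)
  moreover have "- ((q - p) * ln (q - p)) \<le> (q - p) * ln n + 1 / n"
    using assms by (intro neg_x_ln_le) auto
  moreover have "0 \<le> (q - p) * ln n" "0 \<le> 1 / n"
    using assms by auto
  ultimately show ?thesis using up assms by (intro abs_leI) linarith+
qed

lemma entropy_diff_le:
  fixes p q :: "'a \<Rightarrow> real"
  assumes fin: "finite I" and card: "card I \<le> n"
    and p: "\<And>i. i \<in> I \<Longrightarrow> 0 \<le> p i" "sum p I = 1"
    and q: "\<And>i. i \<in> I \<Longrightarrow> 0 \<le> q i" "sum q I = 1"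
  shows "\<bar>(\<Sum>i\<in>I. p i * log 2 (p i)) - (\<Sum>i\<in>I. q i * log 2 (q i))\<bar>
           \<le> (\<Sum>i\<in>I. \<bar>p i - q i\<bar>) * log 2 (real n) + 3 / ln 2"
proof -
  \<comment> \<open>Total mass 1 forces an outcome to exist, so n \<ge> 1 as the pointwise estimate
    requires.\<close>
  have "I \<noteq> {}" using p(2) by auto
  hence n: "real n \<ge> 1" using fin card by (metis Suc_leI card_gt_0_iff le_trans of_nat_1 of_nat_le_iff One_nat_def)
  have le1: "p i \<le> 1" "q i \<le> 1" if "i \<in> I" for i
    using member_le_sum[of i I p] member_le_sum[of i I q] p q fin that by auto
  have "\<bar>p i * ln (p i) - q i * ln (q i)\<bar> \<le> \<bar>p i - q i\<bar> * ln n + \<bar>p i - q i\<bar> + 1 / n"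
    if "i \<in> I" for i
    using x_ln_diff_le[of "p i" "q i" n] x_ln_diff_le[of "q i" "p i" n] p(1) q(1) le1 n that
    by (cases "p i \<le> q i") (auto simp: abs_minus_commute)
  hence "\<bar>\<Sum>i\<in>I. p i * ln (p i) - q i * ln (q i)\<bar>
      \<le> (\<Sum>i\<in>I. \<bar>p i - q i\<bar> * ln n + \<bar>p i - q i\<bar> + 1 / n)"
    by (intro order.trans[OF sum_abs] sum_mono)
  also have "\<dots> = (\<Sum>i\<in>I. \<bar>p i - q i\<bar>) * ln n + (\<Sum>i\<in>I. \<bar>p i - q i\<bar>) + card I / n"
    by (simp add: sum.distrib sum_distrib_right)
  finally have "\<bar>(\<Sum>i\<in>I. p i * ln (p i)) - (\<Sum>i\<in>I. q i * ln (q i))\<bar>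
      \<le> (\<Sum>i\<in>I. \<bar>p i - q i\<bar>) * ln n + (\<Sum>i\<in>I. \<bar>p i - q i\<bar>) + card I / n"
    by (simp add: sum_subtractf)
  \<comment> \<open>The constant 3 is 2 + 1: the l1 distance of two distributions is at most 2, and
    at most \<open>n\<close> errors 1/n sum to at most 1. Dividing by ln 2 then passes to base
    2.\<close>
  moreover have "(\<Sum>i\<in>I. \<bar>p i - q i\<bar>) \<le> (\<Sum>i\<in>I. p i + q i)"
    using p(1) q(1) by (intro sum_mono) (smt (verit))
  moreover have "(\<Sum>i\<in>I. p i + q i) = 2" by (simp add: sum.distrib p q)
  moreover have "card I / n \<le> 1" using card n by simp
  ultimately have "\<bar>(\<Sum>i\<in>I. p i * ln (p i)) - (\<Sum>i\<in>I. q i * ln (q i))\<bar>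
      \<le> (\<Sum>i\<in>I. \<bar>p i - q i\<bar>) * ln n + 3" by linarith
  hence "\<bar>(\<Sum>i\<in>I. p i * ln (p i)) - (\<Sum>i\<in>I. q i * ln (q i))\<bar> / ln 2
      \<le> ((\<Sum>i\<in>I. \<bar>p i - q i\<bar>) * ln n + 3) / ln 2"
    by (intro divide_right_mono) auto
  thus ?thesis
    by (simp add: log_def sum_divide_distrib[symmetric] diff_divide_distrib[symmetric] add_divide_distrib)
qed

text \<open>On a set without upper bound the real supremum is the fixed junk value \<open>LEAST z. False\<close>, and
  two families at bounded distance are either both bounded above or both unbounded.\<close>
lemma SUP_diff_le:
  fixes f g :: "'a \<Rightarrow> real"
  assumes "\<And>x. x \<in> S \<Longrightarrow> \<bar>f x - g x\<bar> \<le> b" and b: "0 \<le> b"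
  shows "\<bar>(SUP x\<in>S. f x) - (SUP x\<in>S. g x)\<bar> \<le> b"
proof -
  have unbdd: "(SUP x\<in>S. h x) = (LEAST z. False)" if "\<not> bdd_above (h ` S)" for h :: "'a \<Rightarrow> real"
  proof -
    have "(\<lambda>z. \<forall>y\<in>h ` S. y \<le> z) = (\<lambda>z. False)"
      using that by (auto simp: bdd_above_def fun_eq_iff)
    thus ?thesis by (simp only: Sup_real_def)
  qed
  \<comment> \<open>One-sided comparison, used in both directions: an upper bound for
    \<open>k\<close> also bounds \<open>h\<close>, so boundedness above transfers between the two
    families.\<close>
  have le: "bdd_above (h ` S) \<and> (S \<noteq> {} \<longrightarrow> (SUP x\<in>S. h x) \<le> (SUP x\<in>S. k x) + b)"
    if bdd: "bdd_above (k ` S)" and hk: "\<forall>x\<in>S. h x \<le> k x + b" for h k :: "'a \<Rightarrow> real"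
  proof -
    have *: "h x \<le> (SUP x\<in>S. k x) + b" if "x \<in> S" for x
      using bspec[OF hk that] cSUP_upper[OF that bdd] by simp
    thus ?thesis by (auto intro!: bdd_aboveI2 cSUP_least)
  qed
  have fg: "\<forall>x\<in>S. f x \<le> g x + b" "\<forall>x\<in>S. g x \<le> f x + b"
    using assms(1) by (auto simp: abs_le_iff algebra_simps)
  show ?thesis
  proof (cases "S = {}")
    case False
    show ?thesis
    proof (cases "bdd_above (g ` S)")
      case True
      note f_le = le[of g f, OF True fg(1)]
      note g_le = le[of f g, OF conjunct1[OF f_le] fg(2)]
      show ?thesis using f_le g_le False by (auto simp: abs_le_iff)
    next
      case ubg: False
      hence "\<not> bdd_above (f ` S)" using le[of f g, OF _ fg(2)] by metis
      thus ?thesis using unbdd ubg b by simp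
    qed
  qed (use b in simp)
qed

section \<open>Outcome probabilities and the trace norm\<close>

lemma trace_mult_comm:
  assumes "A \<in> carrier_mat m n" "B \<in> carrier_mat n m"
  shows "mat_trace (A * B) = mat_trace (B * A)"
proof -
  have "mat_trace (A * B) = (\<Sum>i<m. \<Sum>j<n. A $$ (i, j) * B $$ (j, i))"
    using assms by (simp add: mat_trace_def scalar_prod_def lessThan_atLeast0)
  also have "\<dots> = (\<Sum>j<n. \<Sum>i<m. B $$ (j, i) * A $$ (i, j))"
    by (subst sum.swap) (simp add: mult.commute)
  also have "\<dots> = mat_trace (B * A)"
    using assms by (simp add: mat_trace_def scalar_prod_def lessThan_atLeast0)
  finally show ?thesis .
qed

lemma trace_minus:
  assumes "A \<in> carrier_mat n n" "B \<in> carrier_mat n n"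
  shows "mat_trace (A - B) = mat_trace A - mat_trace B"
  using assms by (simp add: mat_trace_def sum_subtractf)

lemma outcome_prob_minus:
  assumes "A \<in> carrier_mat n n" "B \<in> carrier_mat n n" "P \<in> carrier_mat n n"
  shows "outcome_prob (A - B) P = outcome_prob A P - outcome_prob B P"
proof -
  have "(A - B) * P = A * P - B * P" using assms by (rule minus_mult_distrib_mat)
  thus ?thesis
    unfolding outcome_prob_def using assms by (simp add: trace_minus[of _ n])
qed

lemma measurement_carrier:
  "von_neumann_measurement n \<P> \<Longrightarrow> P \<in> \<P> \<Longrightarrow> P \<in> carrier_mat n n"
  by (auto simp: von_neumann_measurement_def rank_one_projector_def)

text \<open>Completeness of the measurement and linearity of the trace. It serves three times: for
  states (total probability 1), for the absolute value of a Hermitian matrix, and for the identity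
  (counting outcomes).\<close>

lemma sum_outcome_prob:
  assumes X: "X \<in> carrier_mat n n" and M: "von_neumann_measurement n \<P>"
  shows "(\<Sum>P\<in>\<P>. outcome_prob X P) = Re (mat_trace X)"
proof -
  have one: "(\<Sum>P\<in>\<P>. P $$ (j, i)) = 1\<^sub>m n $$ (j, i)" if "i < n" "j < n" for i j
  proof -
    have "mat n n (\<lambda>(i, j). \<Sum>P\<in>\<P>. P $$ (i, j)) $$ (j, i) = 1\<^sub>m n $$ (j, i)"
      using M by (simp add: von_neumann_measurement_def)
    thus ?thesis using that by simp
  qed
  have "mat_trace (X * P) = (\<Sum>i<n. \<Sum>j<n. X $$ (i, j) * P $$ (j, i))" if "P \<in> \<P>" for P
    using X measurement_carrier[OF M that]
    by (simp add: mat_trace_def scalar_prod_def lessThan_atLeast0)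
  hence "(\<Sum>P\<in>\<P>. mat_trace (X * P)) = (\<Sum>P\<in>\<P>. \<Sum>i<n. \<Sum>j<n. X $$ (i, j) * P $$ (j, i))"
    by (rule sum.cong[OF refl])
  also have "\<dots> = (\<Sum>i<n. \<Sum>j<n. X $$ (i, j) * (\<Sum>P\<in>\<P>. P $$ (j, i)))"
    by (subst sum.swap, rule sum.cong, simp, subst sum.swap, simp add: sum_distrib_left)
  also have "\<dots> = (\<Sum>i<n. \<Sum>j<n. X $$ (i, j) * (if j = i then 1 else 0))"
    by (intro sum.cong refl) (simp add: one)
  also have "\<dots> = mat_trace X"
    using X by (simp add: mat_trace_def if_distrib sum.delta cong: if_cong)
  finally show ?thesis
    unfolding outcome_prob_def by (metis Re_sum)
qed

section \<open>Positivity: projectors, outcome probabilities and hermiticity\<close>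

lemma adjoint_mult_mult_diag:
  assumes X: "X \<in> carrier_mat n n" and Q: "Q \<in> carrier_mat n n" and k: "k < n"
  shows "(mat_adjoint Q * X * Q) $$ (k, k) = (X *\<^sub>v col Q k) \<bullet>c col Q k"
proof -
  have "mat_adjoint Q * X * Q = mat_adjoint Q * (X * Q)"
    using X Q by (intro square_mult_assoc[of _ n]) auto
  also have "\<dots> $$ (k, k) = row (mat_adjoint Q) k \<bullet> (X *\<^sub>v col Q k)"
    using X Q k by (subst index_mult_mat) (auto simp: mult_mat_vec_def)
  also have "row (mat_adjoint Q) k = conjugate (col Q k)"
    using Q k by (intro eq_vecI) auto
  also have "\<dots> \<bullet> (X *\<^sub>v col Q k) = (X *\<^sub>v col Q k) \<bullet>c col Q k"
    using X Q k by (intro comm_scalar_prod[of _ n]) auto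
  finally show ?thesis .
qed

text \<open>These entries are values of the quadratic form at the columns of \<open>Q\<close>; in
  this form positivity enters the trace computations.\<close>

lemma pos_semidef_conj_diag_nonneg:
  assumes X: "pos_semidef n X" and Q: "Q \<in> carrier_mat n n" and k: "k < n"
  shows "0 \<le> (mat_adjoint Q * X * Q) $$ (k, k)"
  using assms by (subst adjoint_mult_mult_diag[of _ n]) (auto simp: pos_semidef_def)

lemma pos_semidef_one: "pos_semidef n (1\<^sub>m n)"
  by (auto simp: pos_semidef_def)

text \<open>Since \<open>P = P\<^sup>\<dagger>P\<close>, the quadratic form at \<open>v\<close> is
  the squared norm of \<open>P v\<close>.\<close>

lemma pos_semidef_projector:
  assumes P: "P \<in> carrier_mat n n" "mat_adjoint P = P" "P * P = P"
  shows "pos_semidef n P"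
  unfolding pos_semidef_def
proof (intro conjI ballI)
  fix v :: "complex vec" assume v: "v \<in> carrier_vec n"
  \<comment> \<open>All columns are \<open>v\<close>, so the form at \<open>v\<close> is the (0,0)
    entry of a conjugated matrix and the lemma on such entries applies with X = 1. Dimension 0 has
    no such entry and is treated apart.\<close>
  let ?V = "mat_of_cols n (replicate n v)"
  show "0 \<le> (P *\<^sub>v v) \<bullet>c v"
  proof (cases "n = 0")
    case True
    thus ?thesis using v P by (simp add: scalar_prod_def)
  next
    case False
    have V: "?V \<in> carrier_mat n n" "col ?V 0 = v" using False v by auto
    have "mat_adjoint ?V * P * ?V = mat_adjoint ?V * (mat_adjoint P * P) * ?V"
      using P by simp
    also have "\<dots> = mat_adjoint (P * ?V) * 1\<^sub>m n * (P * ?V)"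
      using P(1) V(1)
      by (simp only: adjoint_mult[of _ n n _ n])
         (simp add: square_mult_assoc[of _ n])
    also have "0 \<le> \<dots> $$ (0, 0)"
      using pos_semidef_conj_diag_nonneg[OF pos_semidef_one, of "P * ?V" n 0] P V(1) False by simp
    finally show ?thesis
      using adjoint_mult_mult_diag[OF P(1) V(1), of 0] False V(2) by simp
  qed
qed (use P in simp)

text \<open>Idempotence and cyclicity turn Tr(XP) into Tr(PXP), whose diagonal entries are
  nonnegative.\<close>

lemma outcome_prob_nonneg:
  assumes X: "pos_semidef n X" and P: "rank_one_projector n P"
  shows "0 \<le> outcome_prob X P"
proof -
  have carr: "X \<in> carrier_mat n n" "P \<in> carrier_mat n n" "mat_adjoint P = P" "P * P = P"
    using assms by (auto simp: pos_semidef_def rank_one_projector_def)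
  have "mat_trace (X * P) = mat_trace (X * P * P)"
    using carr by (simp add: square_mult_assoc[of _ n])
  also have "\<dots> = mat_trace (mat_adjoint P * X * P)"
    using carr by (subst trace_mult_comm[of _ n n]) (auto simp: square_mult_assoc[of _ n])
  also have "0 \<le> \<dots>"
    using carr pos_semidef_conj_diag_nonneg[OF X carr(2)]
    by (auto simp: mat_trace_def intro!: sum_nonneg)
  finally show ?thesis by (simp add: outcome_prob_def less_eq_complex_def)
qed

text \<open>Polarisation: the form is real at e_i + c e_j for every complex \<open>c\<close>, and a
  few values of \<open>c\<close> determine the entries.\<close>

lemma pos_semidef_hermitian:
  assumes "pos_semidef n A"
  shows "mat_adjoint A = A"
proof -
  have A: "A \<in> carrier_mat n n" and nn: "\<And>v. v \<in> carrier_vec n \<Longrightarrow> 0 \<le> (A *\<^sub>v v) \<bullet>c v"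
    using assms by (auto simp: pos_semidef_def)
  have form: "(A *\<^sub>v (unit_vec n i + c \<cdot>\<^sub>v unit_vec n j)) \<bullet>c (unit_vec n i + c \<cdot>\<^sub>v unit_vec n j)
      = A $$ (i, i) + c * A $$ (i, j) + cnj c * A $$ (j, i) + c * cnj c * A $$ (j, j)"
    if "i < n" "j < n" for i j c
  proof -
    let ?w = "unit_vec n i + c \<cdot>\<^sub>v unit_vec n j"
    have "A *\<^sub>v ?w = col A i + c \<cdot>\<^sub>v col A j"
      using A that by (intro eq_vecI) (auto simp: scalar_prod_add_distrib[of _ n] row_carrier_vec)
    moreover have "conjugate ?w = unit_vec n i + cnj c \<cdot>\<^sub>v unit_vec n j"
      using that by (intro eq_vecI) auto
    moreover have "(col A i + c \<cdot>\<^sub>v col A j) \<bullet> (unit_vec n i + cnj c \<cdot>\<^sub>v unit_vec n j)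
      = A $$ (i, i) + c * A $$ (i, j) + cnj c * A $$ (j, i) + c * cnj c * A $$ (j, j)"
      using A that by (simp add: scalar_prod_add_distrib[of _ n] scalar_prod_right_unit[of _ n] algebra_simps)
    ultimately show ?thesis by simp
  qed
  show ?thesis
  proof (intro eq_matI)
    fix i j assume "i < dim_row A" "j < dim_col A"
    hence ij: "i < n" "j < n" using A by auto
    have im0: "Im (A $$ (i, i) + c * A $$ (i, j) + cnj c * A $$ (j, i) + c * cnj c * A $$ (j, j)) = 0"
      if "i < n" "j < n" for i j c
      using nn[of "unit_vec n i + c \<cdot>\<^sub>v unit_vec n j"] form[OF that, of c]
      by (simp add: less_eq_complex_def)
    \<comment> \<open>c = 0 makes the diagonal real; then c = 1 gives opposite imaginary parts of
      the (i,j) and (j,i) entries, and c = \<i> gives equal real parts.\<close>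
    have "Im (A $$ (i, i)) = 0" "Im (A $$ (j, j)) = 0"
      using im0[OF ij, of 0] im0[OF ij(2,2), of 0] by simp_all
    thus "mat_adjoint A $$ (i, j) = A $$ (i, j)"
      using im0[OF ij, of 1] im0[OF ij, of \<i>] A ij by (simp add: complex_eq_iff)
  qed (use A in auto)
qed

section \<open>The trace norm of a Hermitian matrix and the outcome distribution\<close>

lemma diagonalised_eq:
  fixes A :: "complex mat"
  assumes U: "U \<in> carrier_mat n n" "mat_adjoint U * U = 1\<^sub>m n" and A: "A \<in> carrier_mat n n"
    and D: "mat_adjoint U * A * U = D"
  shows "A = U * D * mat_adjoint U"
proof -
  have U': "U * mat_adjoint U = 1\<^sub>m n"
    using mat_mult_left_right_inverse[OF _ U(1) U(2)] U(1) by simp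
  have "U * D * mat_adjoint U = (U * mat_adjoint U) * A * (U * mat_adjoint U)"
    unfolding D[symmetric] using U(1) A by (simp add: square_mult_assoc[of _ n])
  thus ?thesis using U' A by simp
qed

text \<open>Here \<open>A\<^sup>\<dagger>A = A\<^sup>2\<close> is similar to the diagonal matrix of
  the squares of the \<open>d k\<close>, and the square root of such a square is the absolute
  value.\<close>

lemma trace_norm_hermitian:
  assumes A: "A \<in> carrier_mat n n" "mat_adjoint A = A"
    and U: "U \<in> carrier_mat n n" "mat_adjoint U * U = 1\<^sub>m n"
    and D: "mat_adjoint U * A * U = mat_diag n (\<lambda>k. complex_of_real (d k))"
  shows "trace_norm A = (\<Sum>k<n. \<bar>d k\<bar>)"
proof -
  let ?D = "mat_diag n (\<lambda>k. complex_of_real (d k))"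
  let ?D2 = "mat_diag n (\<lambda>k. complex_of_real ((d k)\<^sup>2))"
  have U': "U * mat_adjoint U = 1\<^sub>m n"
    using mat_mult_left_right_inverse[OF _ U(1) U(2)] U(1) by simp
  note A_eq = diagonalised_eq[OF U A(1) D]
  have "A * A = (U * ?D * mat_adjoint U) * (U * ?D * mat_adjoint U)"
    by (simp only: A_eq[symmetric])
  also have "\<dots> = U * ?D * (mat_adjoint U * U) * ?D * mat_adjoint U"
    using U(1) by (simp add: square_mult_assoc[of _ n])
  also have "\<dots> = U * (?D * ?D) * mat_adjoint U"
    using U by (simp add: square_mult_assoc[of _ n] left_mult_one_mat[of _ n n] del: mat_diag_diag)
  also have "?D * ?D = ?D2" by (simp add: power2_eq_square)
  finally have "similar_mat_wit (A * A) ?D2 U (mat_adjoint U)"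
    using U U' A by (intro similar_mat_witI[of _ _ n]) auto
  hence "char_poly (A * A) = char_poly ?D2"
    by (intro char_poly_similar) (auto simp: similar_mat_def)
  also have "\<dots> = (\<Prod>a\<leftarrow>diag_mat ?D2. [:- a, 1:])"
    by (rule char_poly_upper_triangular[of _ n]) (auto simp: mat_diag_def)
  also have "diag_mat ?D2 = map (\<lambda>k. complex_of_real ((d k)\<^sup>2)) [0..<n]"
    by (auto simp: diag_mat_def mat_diag_def)
  finally have cp: "char_poly (A * A) = (\<Prod>a\<leftarrow>map (\<lambda>k. complex_of_real ((d k)\<^sup>2)) [0..<n]. [:- a, 1:])" .
  \<comment> \<open>Roots are collected as a multiset, so repeated eigenvalues keep their
    multiplicity.\<close>
  have "proots (\<Prod>a\<leftarrow>as. [:- a, 1:]) = mset as" for as :: "complex list"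
  proof (induction as)
    case (Cons a as)
    have "(\<Prod>a\<leftarrow>as. [:- a, 1:]) \<noteq> 0" by (auto simp: prod_list_zero_iff)
    hence "proots ([:- a, 1:] * (\<Prod>a\<leftarrow>as. [:- a, 1:])) = add_mset a (mset as)"
      using Cons by (subst proots_mult) auto
    thus ?case by simp
  qed simp
  from this[of "map (\<lambda>k. complex_of_real ((d k)\<^sup>2)) [0..<n]"]
  have "proots (char_poly (mat_adjoint A * A)) = mset (map (\<lambda>k. complex_of_real ((d k)\<^sup>2)) [0..<n])"
    unfolding A(2) cp .
  hence "trace_norm A = (\<Sum>x\<in>#mset (map (\<lambda>k. complex_of_real ((d k)\<^sup>2)) [0..<n]). sqrt (Re x))"
    unfolding trace_norm_def by (rule arg_cong)
  also have "\<dots> = (\<Sum>k\<leftarrow>[0..<n]. \<bar>d k\<bar>)"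
    by (simp only: mset_map[symmetric] sum_mset_sum_list map_map o_def) simp
  also have "\<dots> = (\<Sum>k<n. \<bar>d k\<bar>)"
    by (simp add: interv_sum_list_conv_sum_set_nat lessThan_atLeast0)
  finally show ?thesis .
qed

lemma trace_norm_hermitian_nonneg:
  assumes "A \<in> carrier_mat n n" "mat_adjoint A = A"
  shows "0 \<le> trace_norm A"
proof -
  obtain U d where "U \<in> carrier_mat n n" "mat_adjoint U * U = 1\<^sub>m n"
    "mat_adjoint U * A * U = mat_diag n (\<lambda>k. complex_of_real (d k))"
    using hermitian_diagonalisation[OF assms] by blast
  from trace_norm_hermitian[OF assms this] show ?thesis by (simp add: sum_nonneg)
qed

text \<open>Cyclicity of the trace. The weights do not depend on \<open>d\<close>, so replacing
  eigenvalues by their absolute values can be compared term by term.\<close>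

lemma outcome_prob_diagonal:
  assumes U: "U \<in> carrier_mat n n" and P: "P \<in> carrier_mat n n"
  shows "outcome_prob (U * mat_diag n (\<lambda>k. complex_of_real (d k)) * mat_adjoint U) P
    = (\<Sum>k<n. d k * Re ((mat_adjoint U * P * U) $$ (k, k)))"
proof -
  let ?D = "mat_diag n (\<lambda>k. complex_of_real (d k))"
  have "mat_trace (U * ?D * mat_adjoint U * P) = mat_trace (U * (?D * (mat_adjoint U * P)))"
    using U P by (simp add: square_mult_assoc[of _ n])
  also have "\<dots> = mat_trace (?D * (mat_adjoint U * P * U))"
    using U P by (subst trace_mult_comm[of _ n n]) (auto simp: square_mult_assoc[of _ n])
  also have "\<dots> = (\<Sum>k<n. complex_of_real (d k) * (mat_adjoint U * P * U) $$ (k, k))"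
    using U P by (subst mat_diag_mult_left[of _ n n]) (auto simp: mat_trace_def)
  finally show ?thesis unfolding outcome_prob_def by simp
qed

lemma sum_abs_outcome_prob_le_trace_norm:
  assumes A: "A \<in> carrier_mat n n" "mat_adjoint A = A"
    and M: "von_neumann_measurement n \<P>"
  shows "(\<Sum>P\<in>\<P>. \<bar>outcome_prob A P\<bar>) \<le> trace_norm A"
proof -
  obtain U d where U: "U \<in> carrier_mat n n" "mat_adjoint U * U = 1\<^sub>m n"
    and D: "mat_adjoint U * A * U = mat_diag n (\<lambda>k. complex_of_real (d k))"
    using hermitian_diagonalisation[OF A] by blast
  \<comment> \<open>\<open>B\<close> is the absolute value of \<open>A\<close>. It dominates
    \<open>A\<close> in every outcome because the weights are nonnegative, and its trace is the
    trace norm of \<open>A\<close>.\<close>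
  define B where "B = U * mat_diag n (\<lambda>k. complex_of_real \<bar>d k\<bar>) * mat_adjoint U"
  have B: "B \<in> carrier_mat n n" using U by (simp add: B_def)
  have "\<bar>outcome_prob A P\<bar> \<le> outcome_prob B P" if "P \<in> \<P>" for P
  proof -
    have P: "P \<in> carrier_mat n n" "pos_semidef n P"
      using M that pos_semidef_projector
      by (auto simp: von_neumann_measurement_def rank_one_projector_def)
    have w: "0 \<le> Re ((mat_adjoint U * P * U) $$ (k, k))" if "k < n" for k
      using pos_semidef_conj_diag_nonneg[OF P(2) U(1) that] by (simp add: less_eq_complex_def)
    have "\<bar>outcome_prob A P\<bar> = \<bar>\<Sum>k<n. d k * Re ((mat_adjoint U * P * U) $$ (k, k))\<bar>"
      by (subst diagonalised_eq[OF U A(1) D]) (simp only: outcome_prob_diagonal[OF U(1) P(1)])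
    also have "\<dots> \<le> (\<Sum>k<n. \<bar>d k\<bar> * Re ((mat_adjoint U * P * U) $$ (k, k)))"
      using w by (intro order.trans[OF sum_abs] sum_mono) (simp add: abs_mult)
    also have "\<dots> = outcome_prob B P"
      unfolding B_def by (rule outcome_prob_diagonal[OF U(1) P(1), symmetric])
    finally show ?thesis .
  qed
  hence "(\<Sum>P\<in>\<P>. \<bar>outcome_prob A P\<bar>) \<le> (\<Sum>P\<in>\<P>. outcome_prob B P)"
    by (rule sum_mono)
  also have "\<dots> = Re (mat_trace B)" by (rule sum_outcome_prob[OF B M])
  also have "mat_trace B = mat_trace (mat_adjoint U * (U * mat_diag n (\<lambda>k. complex_of_real \<bar>d k\<bar>)))"
    unfolding B_def using U by (intro trace_mult_comm[of _ n n]) auto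
  also have "mat_adjoint U * (U * mat_diag n (\<lambda>k. complex_of_real \<bar>d k\<bar>))
      = mat_adjoint U * U * mat_diag n (\<lambda>k. complex_of_real \<bar>d k\<bar>)"
    using U(1) by (simp add: square_mult_assoc[of _ n])
  also have "\<dots> = mat_diag n (\<lambda>k. complex_of_real \<bar>d k\<bar>)"
    unfolding U(2) by (rule left_mult_one_mat[OF mat_diag_dim])
  also have "Re (mat_trace (mat_diag n (\<lambda>k. complex_of_real \<bar>d k\<bar>))) = (\<Sum>k<n. \<bar>d k\<bar>)" by (simp add: mat_trace_def mat_diag_def)
  also have "\<dots> = trace_norm A" by (rule trace_norm_hermitian[OF A U D, symmetric])
  finally show ?thesis .
qed

section \<open>The number of outcomes of a measurement\<close>

lemma rank_one_projector_trace_ge_1: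
  assumes "rank_one_projector n P"
  shows "1 \<le> outcome_prob (1\<^sub>m n) P"
proof -
  have P: "P \<in> carrier_mat n n" "mat_adjoint P = P" "P * P = P" "vec_space.rank n P = 1"
    using assms by (auto simp: rank_one_projector_def)
  interpret vec_space "TYPE(complex)" n .
  have P0: "P \<noteq> 0\<^sub>m n n" using P(4) rank_0I[of n] by auto
  obtain U d where U: "U \<in> carrier_mat n n" "mat_adjoint U * U = 1\<^sub>m n"
    and D: "mat_adjoint U * P * U = mat_diag n (\<lambda>k. complex_of_real (d k))"
    using hermitian_diagonalisation[OF P(1,2)] by blast
  let ?D = "mat_diag n (\<lambda>k. complex_of_real (d k))"
  note P_eq = diagonalised_eq[OF U P(1) D]
  have U': "U * mat_adjoint U = 1\<^sub>m n"
    using mat_mult_left_right_inverse[OF _ U(1) U(2)] U(1) by simp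
  have "?D * ?D = mat_adjoint U * P * (U * mat_adjoint U) * P * U"
    unfolding D[symmetric] using U(1) P(1) by (simp add: square_mult_assoc[of _ n])
  also have "\<dots> = mat_adjoint U * (P * P) * U"
    unfolding U' using U(1) P(1) by (simp add: square_mult_assoc[of _ n])
  also have "\<dots> = ?D" using P D by simp
  finally have DD: "?D * ?D = ?D" .
  \<comment> \<open>Idempotence survives the change of basis, so each eigenvalue equals its square.
    As \<open>P\<close> is nonzero, some eigenvalue is 1 and the trace is at least 1.\<close>
  have d01: "d k = 0 \<or> d k = 1" if "k < n" for k
    using arg_cong[OF DD[unfolded mat_diag_diag], of "\<lambda>M. Re (M $$ (k, k))"] that
    by (simp add: mat_diag_def)
  have "\<exists>k<n. d k \<noteq> 0"
  proof (rule ccontr)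
    assume "\<not> ?thesis"
    hence "?D = 0\<^sub>m n n" by (intro eq_matI) (auto simp: mat_diag_def)
    thus False using P_eq U P0 by simp
  qed
  then obtain k where k: "k < n" "d k = 1" using d01 by blast
  hence "1 \<le> (\<Sum>k<n. d k)"
    using d01 by (metis lessThan_iff finite_lessThan member_le_sum order.refl zero_le_one Diff_iff)
  \<comment> \<open>With the identity in place of the projector, the weights are the diagonal
    entries of \<open>U\<^sup>\<dagger>U = 1\<close>.\<close>
  also have "(\<Sum>k<n. d k) = outcome_prob P (1\<^sub>m n)"
    by (subst P_eq, subst outcome_prob_diagonal[OF U(1)]) (use U in auto)
  also have "\<dots> = outcome_prob (1\<^sub>m n) P" using P(1) by (simp add: outcome_prob_def)
  finally show ?thesis .
qed

text \<open>The traces of the projectors sum to Tr 1 = n, and each is at least 1.\<close>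

lemma card_measurement_le:
  assumes M: "von_neumann_measurement n \<P>"
  shows "card \<P> \<le> n"
proof -
  have "1 \<le> outcome_prob (1\<^sub>m n) P" if "P \<in> \<P>" for P
    using M that by (intro rank_one_projector_trace_ge_1) (simp add: von_neumann_measurement_def)
  hence "(\<Sum>P\<in>\<P>. 1) \<le> (\<Sum>P\<in>\<P>. outcome_prob (1\<^sub>m n) P)"
    by (rule sum_mono)
  also have "\<dots> = Re (mat_trace (1\<^sub>m n))" by (rule sum_outcome_prob[OF one_carrier_mat M])
  also have "\<dots> = n" by (simp add: mat_trace_def)
  finally show ?thesis by simp
qed

section \<open>Continuity of the Klein entropy and of the entanglement parameter\<close>

lemma density_diff_hermitian:
  assumes "\<rho>\<^sub>1 \<in> density_matrices n" "\<rho>\<^sub>2 \<in> density_matrices n"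
  shows "\<rho>\<^sub>1 - \<rho>\<^sub>2 \<in> carrier_mat n n" "mat_adjoint (\<rho>\<^sub>1 - \<rho>\<^sub>2) = \<rho>\<^sub>1 - \<rho>\<^sub>2"
proof -
  have psd: "pos_semidef n \<rho>\<^sub>1" "pos_semidef n \<rho>\<^sub>2"
    using assms by (auto simp: density_matrices_def)
  then have carr: "\<rho>\<^sub>1 \<in> carrier_mat n n" "\<rho>\<^sub>2 \<in> carrier_mat n n"
    by (auto simp: pos_semidef_def)
  show "\<rho>\<^sub>1 - \<rho>\<^sub>2 \<in> carrier_mat n n" by (rule minus_carrier_mat[OF carr(2)])
  show "mat_adjoint (\<rho>\<^sub>1 - \<rho>\<^sub>2) = \<rho>\<^sub>1 - \<rho>\<^sub>2"
    using carr psd by (simp add: adjoint_minus[of _ n n] pos_semidef_hermitian)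
qed

lemma klein_entropy_diff_le:
  assumes \<rho>: "\<rho>\<^sub>1 \<in> density_matrices n" "\<rho>\<^sub>2 \<in> density_matrices n"
    and M: "von_neumann_measurement n \<P>"
  shows "\<bar>klein_entropy \<rho>\<^sub>1 \<P> - klein_entropy \<rho>\<^sub>2 \<P>\<bar>
    \<le> trace_norm (\<rho>\<^sub>1 - \<rho>\<^sub>2) * log 2 (real n) + 3 / ln 2"
proof -
  have psd: "pos_semidef n \<rho>\<^sub>1" "pos_semidef n \<rho>\<^sub>2"
    and tr: "mat_trace \<rho>\<^sub>1 = 1" "mat_trace \<rho>\<^sub>2 = 1"
    using \<rho> by (auto simp: density_matrices_def)
  then have carr: "\<rho>\<^sub>1 \<in> carrier_mat n n" "\<rho>\<^sub>2 \<in> carrier_mat n n"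
    by (auto simp: pos_semidef_def)
  \<comment> \<open>In dimension 0 the trace would be 0 instead of 1. Hence log 2 n \<ge> 0, which
    allows multiplying the trace norm bound by it.\<close>
  have n: "n \<noteq> 0" using tr(1) carr(1) by (auto simp: mat_trace_def intro!: Nat.gr0I)
  have proj: "rank_one_projector n P" if "P \<in> \<P>" for P
    using M that by (simp add: von_neumann_measurement_def)
  have "\<bar>klein_entropy \<rho>\<^sub>1 \<P> - klein_entropy \<rho>\<^sub>2 \<P>\<bar>
      \<le> (\<Sum>P\<in>\<P>. \<bar>outcome_prob \<rho>\<^sub>1 P - outcome_prob \<rho>\<^sub>2 P\<bar>) * log 2 (real n) + 3 / ln 2"
    using entropy_diff_le[of \<P> n "outcome_prob \<rho>\<^sub>1" "outcome_prob \<rho>\<^sub>2"]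
      M card_measurement_le[OF M] outcome_prob_nonneg[OF psd(1) proj] outcome_prob_nonneg[OF psd(2) proj]
      sum_outcome_prob[OF carr(1) M] sum_outcome_prob[OF carr(2) M] tr
    by (simp add: klein_entropy_def von_neumann_measurement_def abs_minus_commute)
  also have "(\<Sum>P\<in>\<P>. \<bar>outcome_prob \<rho>\<^sub>1 P - outcome_prob \<rho>\<^sub>2 P\<bar>) = (\<Sum>P\<in>\<P>. \<bar>outcome_prob (\<rho>\<^sub>1 - \<rho>\<^sub>2) P\<bar>)"
    using outcome_prob_minus[OF carr measurement_carrier[OF M]] by (intro sum.cong) auto
  also have "\<dots> * log 2 (real n) \<le> trace_norm (\<rho>\<^sub>1 - \<rho>\<^sub>2) * log 2 (real n)"
    using n by (intro mult_right_mono sum_abs_outcome_prob_le_trace_norm[OF density_diff_hermitian[OF \<rho>] M]) auto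
  finally show ?thesis by simp
qed

theorem theorem1:
  shows "\<exists>K C :: real. \<forall>d :: nat. d \<ge> 1 \<longrightarrow>
           (\<forall>\<rho>1 \<in> density_matrices (d * d). \<forall>\<rho>2 \<in> density_matrices (d * d).
              \<bar>entropic_entanglement d \<rho>1 - entropic_entanglement d \<rho>2\<bar>
                \<le> K * trace_norm (\<rho>1 - \<rho>2) * log 2 (real d) + C)"
proof (intro exI allI impI ballI)
  fix d :: nat and \<rho>1 \<rho>2
  assume d: "d \<ge> 1" and \<rho>: "\<rho>1 \<in> density_matrices (d * d)" "\<rho>2 \<in> density_matrices (d * d)"
  \<comment> \<open>The witnesses K = 2 and C = 3 / ln 2 are read off from this bound; the factor 2
    is log 2 (d * d) = 2 log 2 d.\<close>
  let ?b = "2 * trace_norm (\<rho>1 - \<rho>2) * log 2 (real d) + 3 / ln 2"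
  have log_sq: "log 2 (real (d * d)) = 2 * log 2 (real d)"
    using d by (simp add: log_mult)
  have diff: "\<bar>klein_entropy \<rho>1 \<P> - klein_entropy \<rho>2 \<P>\<bar> \<le> ?b"
    if "von_neumann_measurement (d * d) \<P>" for \<P>
    using klein_entropy_diff_le[OF \<rho> that] unfolding log_sq by (simp only: mult.assoc mult.left_commute)
  \<comment> \<open>\<open>SUP_diff_le\<close> asks for a nonnegative bound; d \<ge> 1 makes log 2 d
    nonnegative as well.\<close>
  have "0 \<le> trace_norm (\<rho>1 - \<rho>2)"
    using density_diff_hermitian[OF \<rho>] by (rule trace_norm_hermitian_nonneg)
  hence "0 \<le> ?b" using d by simp
  \<comment> \<open>For each measurement the infimum over product states is common to both states
    and cancels, leaving a difference of Klein entropies.\<close>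
  thus "\<bar>entropic_entanglement d \<rho>1 - entropic_entanglement d \<rho>2\<bar> \<le> ?b"
    unfolding entropic_entanglement_def
    by (intro SUP_diff_le) (use diff in \<open>auto simp: abs_minus_commute\<close>)
qed

end
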